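(* Let $\mathcal{R}$ be an $R$-variety. Every $\mathcal{R}$-monoid admits a unique minimal $\mathcal{R}$-system of generators. In addition, such an $\mathcal{R}$-system of generators is finite.
   Context: Let $\mathbb{N}$ be the set of nonnegative integers. A numerical semigroup is a subset $S\subseteq\mathbb{N}$ that is closed under addition, contains $0$, and has $\mathbb{N}\setminus S$ finite. If $S\subsetneq T$ are numerical semigroups, $\mathrm{F}_T(S)=\max(T\setminus S)$. An $R$-variety is a non-empty family $\mathcal{R}$ of numerical semigroups such that: (1) $\mathcal{R}$ has a maximum element with respect to inclusion, denoted $\Delta(\mathcal{R})$; (2) if $S,T\in\mathcal{R}$ then $S\cap T\in\mathcal{R}$; (3) if $S\in\mathcal{R}$ and $S\neq\Delta(\mathcal{R})$ then $S\cup\{\mathrm{F}_{\Delta(\mathcal{R})}(S)\}\in\mathcal{R}$. An $\mathcal{R}$-monoid is a submonoid of $(\mathbb{N},+)$ that is the intersection of a (non-empty, possibly infinite) family of elements of $\mathcal{R}$. For $A\subseteq\Delta(\mathcal{R})$, $\mathcal{R}(A)$ denotes the $\mathcal{R}$-monoid generated by $A$: the intersection of all $\mathcal{R}$-monoids containing $A$. If $M=\mathcal{R}(A)$, then $A$ is an $\mathcal{R}$-system of generators of $M$; it is a minimal $\mathcal{R}$-system of generators of $M$ if moreover $M\neq\mathcal{R}(B)$ for all $B\subsetneq A$. *)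

theory Defs
  imports Main
begin

definition nat_submonoid :: "nat set \<Rightarrow> bool" where
  "nat_submonoid M \<longleftrightarrow> 0 \<in> M \<and> (\<forall>x\<in>M. \<forall>y\<in>M. x + y \<in> M)"

definition numerical_semigroup :: "nat set \<Rightarrow> bool" where
  "numerical_semigroup S \<longleftrightarrow> nat_submonoid S \<and> finite (UNIV - S)"

(* Meaningful only for numerical semigroups S \<subset> T, where T - S is finite and nonempty. *)
definition frobenius_in :: "nat set \<Rightarrow> nat set \<Rightarrow> nat" where
  "frobenius_in T S = Max (T - S)"

(* The maximum element of the family with respect to inclusion; a junk value if there is none. *)
definition Delta :: "nat set set \<Rightarrow> nat set" where
  "Delta R = (GREATEST S. S \<in> R)"

definition R_variety :: "nat set set \<Rightarrow> bool" where
  "R_variety R \<longleftrightarrow>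
     R \<noteq> {} \<and>
     (\<forall>S\<in>R. numerical_semigroup S) \<and>
     (\<exists>D\<in>R. \<forall>S\<in>R. S \<subseteq> D) \<and>
     (\<forall>S\<in>R. \<forall>T\<in>R. S \<inter> T \<in> R) \<and>
     (\<forall>S\<in>R. S \<noteq> Delta R \<longrightarrow> S \<union> {frobenius_in (Delta R) S} \<in> R)"

definition R_monoid :: "nat set set \<Rightarrow> nat set \<Rightarrow> bool" where
  "R_monoid R M \<longleftrightarrow> nat_submonoid M \<and> (\<exists>F. F \<noteq> {} \<and> F \<subseteq> R \<and> M = \<Inter>F)"

(* Meaningful only for A \<subseteq> Delta R, where Delta R itself is an R-monoid containing A,
   so that the intersected family is nonempty. *)
definition R_generated :: "nat set set \<Rightarrow> nat set \<Rightarrow> nat set" where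
  "R_generated R A = \<Inter>{M. R_monoid R M \<and> A \<subseteq> M}"

definition R_system_of_generators :: "nat set set \<Rightarrow> nat set \<Rightarrow> nat set \<Rightarrow> bool" where
  "R_system_of_generators R M A \<longleftrightarrow> A \<subseteq> Delta R \<and> M = R_generated R A"

definition minimal_R_system_of_generators :: "nat set set \<Rightarrow> nat set \<Rightarrow> nat set \<Rightarrow> bool" where
  "minimal_R_system_of_generators R M A \<longleftrightarrow>
     R_system_of_generators R M A \<and> (\<forall>B. B \<subset> A \<longrightarrow> M \<noteq> R_generated R B)"

end

theory Submission
  imports Defs
begin

text \<open>
  Call an element \<open>x\<close> of an \<open>\<R>\<close>-monoid \<open>M\<close> indecomposable if the elements of \<open>M\<close> below \<open>x\<close> do not
  generate it. By well-founded induction the indecomposables generate \<open>M\<close>. The point of the proof is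
  that every \<open>\<R>\<close>-system of generators of \<open>M\<close> must contain all of them, so that they form the least
  system of generators, which is then the only minimal one.

  To see this, let \<open>x\<close> be indecomposable, and choose a semigroup \<open>S \<in> \<R>\<close> that contains the elements of
  \<open>M\<close> below \<open>x\<close> and avoids \<open>x\<close>. The third axiom of an \<open>R\<close>-variety allows filling the gaps of \<open>S\<close> in
  \<open>\<Delta>(\<R>)\<close> one at a time, the largest first. Stopping just before \<open>x\<close> gives a member of \<open>\<R>\<close> that still
  avoids \<open>x\<close> and now contains all of \<open>M - {x}\<close> (lemma \<open>fill_gaps_above\<close>). Hence a subset of \<open>M\<close>
  without \<open>x\<close> cannot generate \<open>x\<close>.

  Finiteness holds because generated \<open>\<R>\<close>-monoids are closed under addition: if \<open>m\<close> is the least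
  positive element of \<open>M\<close>, two distinct indecomposables cannot be congruent modulo \<open>m\<close>, since the
  larger one would be the sum of the smaller one and a multiple of \<open>m\<close>.
\<close>

lemma Delta_in_variety:
  assumes "R_variety R"
  shows "Delta R \<in> R" and "S \<in> R \<Longrightarrow> S \<subseteq> Delta R"
proof -
  obtain D where D: "D \<in> R" "\<forall>S\<in>R. S \<subseteq> D"
    using assms unfolding R_variety_def by blast
  then have "Delta R = D"
    unfolding Delta_def by (intro Greatest_equality) auto
  with D show "Delta R \<in> R" and "S \<in> R \<Longrightarrow> S \<subseteq> Delta R"
    by auto
qed

lemma variety_numerical_semigroup:
  assumes "R_variety R" and "S \<in> R"
  shows "numerical_semigroup S"
  using assms unfolding R_variety_def by blast

lemma R_monoid_subset_Delta:
  assumes "R_variety R" and "R_monoid R M"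
  shows "M \<subseteq> Delta R"
proof -
  obtain F where "F \<noteq> {}" "F \<subseteq> R" "M = \<Inter>F"
    using assms(2) unfolding R_monoid_def by blast
  with Delta_in_variety(2)[OF assms(1)] show ?thesis by blast
qed

text \<open>
  Every \<open>\<R>\<close>-monoid is an intersection of members of \<open>\<R>\<close>, and these members are \<open>\<R>\<close>-monoids themselves;
  so membership in a generated \<open>\<R>\<close>-monoid can be tested against the members of \<open>\<R>\<close> alone.
\<close>

lemma R_generated_eq_Inter_members:
  assumes "R_variety R"
  shows "R_generated R A = \<Inter>{S \<in> R. A \<subseteq> S}"
proof (rule equalityI)
  have "R_monoid R S" if "S \<in> R" for S
  proof -
    have "S = \<Inter>{S}" "{S} \<noteq> {}" "{S} \<subseteq> R" using that by auto
    with variety_numerical_semigroup[OF assms that] show ?thesis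
      unfolding R_monoid_def numerical_semigroup_def by blast
  qed
  then show "R_generated R A \<subseteq> \<Inter>{S \<in> R. A \<subseteq> S}"
    unfolding R_generated_def by blast
  show "\<Inter>{S \<in> R. A \<subseteq> S} \<subseteq> R_generated R A"
    unfolding R_generated_def R_monoid_def by blast
qed

lemma subset_R_generated: "A \<subseteq> R_generated R A"
  unfolding R_generated_def by blast

lemma R_generated_least: "R_monoid R M \<Longrightarrow> A \<subseteq> M \<Longrightarrow> R_generated R A \<subseteq> M"
  unfolding R_generated_def by blast

lemma R_generated_subset_R_generated:
  "A \<subseteq> R_generated R B \<Longrightarrow> R_generated R A \<subseteq> R_generated R B"
  unfolding R_generated_def by blast

lemma nat_submonoid_R_generated: "nat_submonoid (R_generated R A)"
  unfolding R_generated_def R_monoid_def nat_submonoid_def by blast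

lemma nat_submonoid_mult:
  assumes "nat_submonoid M" and "m \<in> M"
  shows "k * m \<in> M"
  using assms by (induction k) (auto simp: nat_submonoid_def)

text \<open>
  Induction on the number of gaps of \<open>S\<close> in \<open>\<Delta>(\<R>)\<close> above \<open>x\<close>: while there is such a gap, the largest gap
  \<open>F\<^bsub>\<Delta>(\<R>)\<^esub>(S)\<close> lies above \<open>x\<close>, and the third axiom of an \<open>R\<close>-variety allows adjoining it.
\<close>

lemma fill_gaps_above:
  assumes var: "R_variety R" and "S \<in> R"
  shows "S \<union> {y \<in> Delta R. x < y} \<in> R"
  using \<open>S \<in> R\<close>
proof (induction "card {y \<in> Delta R - S. x < y}" arbitrary: S rule: less_induct)
  case less
  have "finite (UNIV - S)"
    using variety_numerical_semigroup[OF var less.prems]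
    unfolding numerical_semigroup_def by blast
  then have fin: "finite (Delta R - S)"
    by (rule rev_finite_subset) blast
  show ?case
  proof (cases "{y \<in> Delta R - S. x < y} = {}")
    case True
    then have "S \<union> {y \<in> Delta R. x < y} = S" by blast
    with less.prems show ?thesis by simp
  next
    case False
    define f where "f = frobenius_in (Delta R) S"
    from False obtain y where y: "y \<in> Delta R - S" "x < y" by blast
    have f: "f \<in> Delta R - S"
      using y Max_in[OF fin] unfolding f_def frobenius_in_def by blast
    have "y \<le> f"
      using y fin unfolding f_def frobenius_in_def by simp
    with y have "x < f" by simp
    have "S \<noteq> Delta R" using y by blast
    then have "S \<union> {f} \<in> R"
      using var less.prems unfolding R_variety_def f_def by blast
    moreover have "card {y \<in> Delta R - (S \<union> {f}). x < y} < card {y \<in> Delta R - S. x < y}"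
    proof (rule psubset_card_mono)
      show "finite {y \<in> Delta R - S. x < y}"
        using fin by (rule rev_finite_subset) blast
      show "{y \<in> Delta R - (S \<union> {f}). x < y} \<subset> {y \<in> Delta R - S. x < y}"
        using f \<open>x < f\<close> by blast
    qed
    ultimately have "S \<union> {f} \<union> {y \<in> Delta R. x < y} \<in> R"
      using less.hyps by blast
    moreover have "S \<union> {f} \<union> {y \<in> Delta R. x < y} = S \<union> {y \<in> Delta R. x < y}"
      using f \<open>x < f\<close> by blast
    ultimately show ?thesis by simp
  qed
qed

definition R_indecomposables :: "nat set set \<Rightarrow> nat set \<Rightarrow> nat set" where
  "R_indecomposables R M = {x \<in> M. x \<notin> R_generated R {a \<in> M. a < x}}"

lemma R_generated_indecomposables:
  assumes "R_monoid R M"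
  shows "R_generated R (R_indecomposables R M) = M"
proof (rule equalityI)
  show "R_generated R (R_indecomposables R M) \<subseteq> M"
    using assms by (rule R_generated_least) (auto simp: R_indecomposables_def)
  show "M \<subseteq> R_generated R (R_indecomposables R M)"
  proof
    fix x assume "x \<in> M"
    then show "x \<in> R_generated R (R_indecomposables R M)"
    proof (induction x rule: less_induct)
      case (less x)
      show ?case
      proof (cases "x \<in> R_indecomposables R M")
        case True
        then show ?thesis using subset_R_generated by blast
      next
        case False
        then have "x \<in> R_generated R {a \<in> M. a < x}"
          using less.prems unfolding R_indecomposables_def by blast
        moreover have "{a \<in> M. a < x} \<subseteq> R_generated R (R_indecomposables R M)"
          using less.IH by blast
        ultimately show ?thesis
          using R_generated_subset_R_generated by blast
      qed
    qed
  qed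
qed

text \<open>
  If \<open>x\<close> is indecomposable, some member of \<open>\<R>\<close> avoids \<open>x\<close> but contains \<open>M - {x}\<close>: below \<open>x\<close> by
  indecomposability, above \<open>x\<close> by filling gaps. A system of generators that misses \<open>x\<close> would
  generate only a subset of that member, which misses \<open>x\<close>.
\<close>

lemma indecomposables_subset_generators:
  assumes var: "R_variety R" and sub: "M \<subseteq> Delta R" and gen: "M = R_generated R A"
  shows "R_indecomposables R M \<subseteq> A"
proof
  fix x assume x: "x \<in> R_indecomposables R M"
  then obtain S where S: "S \<in> R" "{a \<in> M. a < x} \<subseteq> S" "x \<notin> S"
    unfolding R_indecomposables_def R_generated_eq_Inter_members[OF var] by blast
  define T where "T = S \<union> {y \<in> Delta R. x < y}"
  have T: "T \<in> R" "x \<notin> T"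
    using fill_gaps_above[OF var S(1)] S(3) unfolding T_def by auto
  show "x \<in> A"
  proof (rule ccontr)
    assume "x \<notin> A"
    have "A \<subseteq> M" using gen subset_R_generated by blast
    have "A \<subseteq> T"
    proof
      fix a assume "a \<in> A"
      with \<open>x \<notin> A\<close> have "a < x \<or> x < a" by (metis linorder_neqE_nat)
      with \<open>a \<in> A\<close> \<open>A \<subseteq> M\<close> sub S(2) show "a \<in> T" unfolding T_def by blast
    qed
    with T have "x \<notin> M"
      unfolding gen R_generated_eq_Inter_members[OF var] by blast
    with x show False unfolding R_indecomposables_def by blast
  qed
qed

lemma finite_indecomposables: "finite (R_indecomposables R M)"
proof (cases "\<exists>m\<in>M. 0 < m")
  case False
  then have "R_indecomposables R M \<subseteq> {0}"
    unfolding R_indecomposables_def by auto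
  then show ?thesis by (rule finite_subset) simp
next
  case True
  define m where "m = (LEAST m. m \<in> M \<and> 0 < m)"
  have m: "m \<in> M" "0 < m"
    using True LeastI_ex[of "\<lambda>m. m \<in> M \<and> 0 < m"] unfolding m_def by blast+
  have least: "m \<le> x" if "x \<in> M" "0 < x" for x
    using that unfolding m_def by (intro Least_le) simp
  have decomposable: False
    if x: "x \<in> R_indecomposables R M" and y: "y \<in> R_indecomposables R M"
      and "x < y" and cong: "x mod m = y mod m" for x y
  proof -
    let ?G = "R_generated R {a \<in> M. a < y}"
    \<comment> \<open>The empty sum \<open>0\<close> is generated by any set, so it is not indecomposable and \<open>m \<le> x\<close>.\<close>
    have "0 \<in> R_generated R {a \<in> M. a < x}"
      using nat_submonoid_R_generated unfolding nat_submonoid_def by blast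
    then have "x \<in> M" "x \<noteq> 0"
      using x unfolding R_indecomposables_def by (blast, metis (lifting) mem_Collect_eq)
    then have "m \<le> x" using least by simp
    then have "x \<in> {a \<in> M. a < y}" "m \<in> {a \<in> M. a < y}"
      using \<open>x \<in> M\<close> \<open>x < y\<close> m by auto
    then have "x \<in> ?G" "m \<in> ?G"
      using subset_R_generated[of "{a \<in> M. a < y}" R] by blast+
    moreover obtain k where "y = x + k * m"
      using cong \<open>x < y\<close> by (metis less_imp_le mod_eq_nat1E mult.commute)
    moreover have "k * m \<in> ?G"
      using nat_submonoid_R_generated \<open>m \<in> ?G\<close> by (rule nat_submonoid_mult)
    ultimately have "y \<in> ?G"
      using nat_submonoid_R_generated[of R "{a \<in> M. a < y}"]
      unfolding nat_submonoid_def by simp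
    with y show False unfolding R_indecomposables_def by blast
  qed
  have "inj_on (\<lambda>x. x mod m) (R_indecomposables R M)"
    by (rule inj_onI) (metis decomposable linorder_neqE_nat)
  moreover have "(\<lambda>x. x mod m) ` R_indecomposables R M \<subseteq> {..<m}"
    using m by auto
  ultimately show ?thesis
    using finite_imageD finite_subset by blast
qed

theorem theorem3p7:
  fixes R :: "nat set set" and M :: "nat set"
  assumes "R_variety R" and "R_monoid R M"
  shows "(\<exists>!A. minimal_R_system_of_generators R M A) \<and>
         (\<forall>A. minimal_R_system_of_generators R M A \<longrightarrow> finite A)"
proof -
  let ?X = "R_indecomposables R M"
  have sub: "M \<subseteq> Delta R" using R_monoid_subset_Delta assms by blast
  have gen: "M = R_generated R ?X"
    using R_generated_indecomposables assms(2) by simp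
  have least: "?X \<subseteq> A" if "M = R_generated R A" for A
    using indecomposables_subset_generators[OF assms(1) sub that] .
  have "?X \<subseteq> Delta R" using sub unfolding R_indecomposables_def by blast
  then have minimal: "minimal_R_system_of_generators R M ?X"
    using gen least
    unfolding minimal_R_system_of_generators_def R_system_of_generators_def by blast
  have "A = ?X" if "minimal_R_system_of_generators R M A" for A
    using that gen least
    unfolding minimal_R_system_of_generators_def R_system_of_generators_def by blast
  with minimal finite_indecomposables show ?thesis by metis
qed

end
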